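(* Let $\mathbf{A}$ be an algebra; all relations below are binary relations on $\mathbf{A}$. (i) If $\mathbf{A}$ satisfies $R \subseteq [R, R^\circ|1]$ for every reflexive compatible relation $R$, then $\mathbf{A}$ satisfies $$R \cap (S \circ T) \cap (T^- \circ S^-) \subseteq \big((S \cap (R^- \circ (S \cap T^-) \circ R)) \circ (T \cap (R^- \circ (S^- \cap T) \circ R))\big)^*$$ for all reflexive compatible relations $R$, $S$, $T$. In particular, if $S,T$ are reflexive compatible relations, $\gamma$ is a congruence and $\gamma \supseteq S \cap T^-$, then $$\gamma \cap (S \circ T) \cap (T^- \circ S^-) \subseteq ((\gamma \cap S) \circ (\gamma \cap T))^*.$$ (ii) If $\mathbf{A}$ satisfies $R \subseteq [R, R|1]$ for every reflexive compatible relation $R$, then $\mathbf{A}$ satisfies $$R \cap (S \circ T) \subseteq \big((S \cap (R^- \circ (S \cap T^-) \circ R)) \circ (T \cap (R^- \circ (S^- \cap T) \circ R))\big)^*$$ for all reflexive compatible relations $R$, $S$, $T$. In particular, if $S,T$ are reflexive compatible relations, $\gamma$ is a congruence and $\gamma \supseteq S \cap T^-$, then $$\gamma \cap (S \circ T) \subseteq ((\gamma \cap S) \circ (\gamma \cap T))^*.$$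
   Context: A binary relation on an algebra $\mathbf{A}$ (with base set $A$) is called compatible (or admissible) if it is preserved by all operations of $\mathbf{A}$ applied coordinatewise. A tolerance is a reflexive, symmetric, compatible relation. For binary relations $R,S$ on $A$: $a\,(R\circ S)\,c$ iff there is $b\in A$ with $a\,R\,b\,S\,c$; $R^-$ is the converse of $R$; $R^*$ is the transitive closure of $R$; $R^\circ$ (superscript) is the smallest tolerance containing $R$. For compatible and reflexive relations $R,S$ on $\mathbf{A}$, $M(R,S)$ is the set of all matrices of the form $$\begin{vmatrix} t(\overline{a},\overline{b}) & t(\overline{a},\overline{b}\,') \\ t(\overline{a}\,',\overline{b}) & t(\overline{a}\,',\overline{b}\,')\end{vmatrix}$$ where $\overline{a},\overline{a}\,'\in A^n$, $\overline{b},\overline{b}\,'\in A^m$ for some $m,n\ge 0$, $t$ is an $(m+n)$-ary term operation of $\mathbf{A}$, and $\overline{a}\,R\,\overline{a}\,'$, $\overline{b}\,S\,\overline{b}\,'$ (componentwise). The commutator $[R,S|1]$ is the transitive closure of the set $$\left\{(z,w) \;\middle|\; \begin{vmatrix} x & x\\ z & w\end{vmatrix}\in M(R,S) \text{ for some } x\in A\right\}.$$ *)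

theory Defs
  imports Main
begin

record ('a, 'f) alg =
  carrier :: "'a set"
  symbols :: "'f set"
  arity :: "'f \<Rightarrow> nat"
  interp :: "'f \<Rightarrow> 'a list \<Rightarrow> 'a"

definition is_algebra :: "('a, 'f) alg \<Rightarrow> bool" where
  "is_algebra \<A> \<longleftrightarrow>
     (\<forall>f \<in> symbols \<A>. \<forall>xs \<in> lists (carrier \<A>).
        length xs = arity \<A> f \<longrightarrow> interp \<A> f xs \<in> carrier \<A>)"

definition compatible :: "('a, 'f) alg \<Rightarrow> 'a rel \<Rightarrow> bool" where
  "compatible \<A> R \<longleftrightarrow>
     R \<subseteq> carrier \<A> \<times> carrier \<A> \<and>
     (\<forall>f \<in> symbols \<A>. \<forall>xs ys. length xs = arity \<A> f \<and> list_all2 (\<lambda>x y. (x, y) \<in> R) xs ys \<longrightarrow>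
        (interp \<A> f xs, interp \<A> f ys) \<in> R)"

definition reflexive_compatible :: "('a, 'f) alg \<Rightarrow> 'a rel \<Rightarrow> bool" where
  "reflexive_compatible \<A> R \<longleftrightarrow> refl_on (carrier \<A>) R \<and> compatible \<A> R"

definition tolerance :: "('a, 'f) alg \<Rightarrow> 'a rel \<Rightarrow> bool" where
  "tolerance \<A> R \<longleftrightarrow> refl_on (carrier \<A>) R \<and> sym R \<and> compatible \<A> R"

definition congruence :: "('a, 'f) alg \<Rightarrow> 'a rel \<Rightarrow> bool" where
  "congruence \<A> R \<longleftrightarrow> equiv (carrier \<A>) R \<and> compatible \<A> R"

definition tolerance_generated :: "('a, 'f) alg \<Rightarrow> 'a rel \<Rightarrow> 'a rel" where
  "tolerance_generated \<A> R = \<Inter> {\<Theta>. tolerance \<A> \<Theta> \<and> R \<subseteq> \<Theta>}"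

text \<open>The intersection is over a nonempty family, and is itself a tolerance, as soon as
  \<open>R\<close> is a relation on the base set; so it is the smallest tolerance containing \<open>R\<close>.\<close>

lemma tolerance_generated_least:
  assumes "is_algebra \<A>" "R \<subseteq> carrier \<A> \<times> carrier \<A>"
  shows "tolerance \<A> (tolerance_generated \<A> R)"
    and "R \<subseteq> tolerance_generated \<A> R"
    and "\<lbrakk>tolerance \<A> \<Theta>; R \<subseteq> \<Theta>\<rbrakk> \<Longrightarrow> tolerance_generated \<A> R \<subseteq> \<Theta>"
proof -
  let ?F = "{\<Theta>. tolerance \<A> \<Theta> \<and> R \<subseteq> \<Theta>}"
  have "(interp \<A> f xs, interp \<A> f ys) \<in> carrier \<A> \<times> carrier \<A>"
    if f: "f \<in> symbols \<A>" and l: "length xs = arity \<A> f"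
      and r: "list_all2 (\<lambda>x y. (x, y) \<in> carrier \<A> \<times> carrier \<A>) xs ys" for f xs ys
  proof -
    have "xs \<in> lists (carrier \<A>)" "ys \<in> lists (carrier \<A>)" "length ys = arity \<A> f"
      using r l by (auto simp: list_all2_conv_all_nth in_set_conv_nth)
    then show ?thesis using assms(1) f l unfolding is_algebra_def by blast
  qed
  then have full: "carrier \<A> \<times> carrier \<A> \<in> ?F"
    using assms(2) by (auto simp: tolerance_def compatible_def refl_on_def sym_def)
  have "(interp \<A> f xs, interp \<A> f ys) \<in> \<Inter> ?F"
    if f: "f \<in> symbols \<A>" and l: "length xs = arity \<A> f"
      and r: "list_all2 (\<lambda>x y. (x, y) \<in> \<Inter> ?F) xs ys" for f xs ys
  proof
    fix \<Theta> assume \<Theta>: "\<Theta> \<in> ?F"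
    then have "list_all2 (\<lambda>x y. (x, y) \<in> \<Theta>) xs ys"
      using r by (auto elim!: list_all2_mono)
    then show "(interp \<A> f xs, interp \<A> f ys) \<in> \<Theta>"
      using \<Theta> f l unfolding tolerance_def compatible_def by blast
  qed
  moreover have "refl_on (carrier \<A>) (\<Inter> ?F)"
    by (auto simp: refl_on_def tolerance_def)
  moreover have "sym (\<Inter> ?F)"
    by (auto simp: sym_def tolerance_def)
  moreover have "\<Inter> ?F \<subseteq> carrier \<A> \<times> carrier \<A>" using full by blast
  ultimately show "tolerance \<A> (tolerance_generated \<A> R)"
    unfolding tolerance_def[of _ "tolerance_generated \<A> R"] compatible_def[of _ "tolerance_generated \<A> R"]
    unfolding tolerance_generated_def by blast
qed (auto simp: tolerance_generated_def)

datatype 'f trm = Var nat | App 'f "'f trm list"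

fun is_term :: "('a, 'f) alg \<Rightarrow> nat \<Rightarrow> 'f trm \<Rightarrow> bool" where
  "is_term \<A> k (Var i) \<longleftrightarrow> i < k"
| "is_term \<A> k (App f ts) \<longleftrightarrow>
     f \<in> symbols \<A> \<and> length ts = arity \<A> f \<and> (\<forall>t \<in> set ts. is_term \<A> k t)"

fun eval_term :: "('a, 'f) alg \<Rightarrow> 'f trm \<Rightarrow> 'a list \<Rightarrow> 'a" where
  "eval_term \<A> (Var i) xs = xs ! i"
| "eval_term \<A> (App f ts) xs = interp \<A> f (map (\<lambda>t. eval_term \<A> t xs) ts)"

text \<open>A term operation is represented by its values on argument lists whose length is its arity;
  its values on other lists are irrelevant.\<close>

definition term_operations :: "('a, 'f) alg \<Rightarrow> nat \<Rightarrow> ('a list \<Rightarrow> 'a) set" where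
  "term_operations \<A> k = {eval_term \<A> t | t. is_term \<A> k t}"

text \<open>The pair \<open>((p, q), (r, s))\<close> stands for the matrix with rows \<open>(p, q)\<close> and \<open>(r, s)\<close>.\<close>

definition matrices :: "('a, 'f) alg \<Rightarrow> 'a rel \<Rightarrow> 'a rel \<Rightarrow> (('a \<times> 'a) \<times> ('a \<times> 'a)) set" where
  "matrices \<A> R S =
     {((t (a @ b), t (a @ b')), (t (a' @ b), t (a' @ b'))) | n m t a a' b b'.
        t \<in> term_operations \<A> (m + n) \<and>
        a \<in> lists (carrier \<A>) \<and> a' \<in> lists (carrier \<A>) \<and> length a = n \<and> length a' = n \<and>
        b \<in> lists (carrier \<A>) \<and> b' \<in> lists (carrier \<A>) \<and> length b = m \<and> length b' = m \<and>
        list_all2 (\<lambda>x y. (x, y) \<in> R) a a' \<and> list_all2 (\<lambda>x y. (x, y) \<in> S) b b'}"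

text \<open>The commutator \<open>[R, S | 1]\<close>.\<close>

definition commutator1 :: "('a, 'f) alg \<Rightarrow> 'a rel \<Rightarrow> 'a rel \<Rightarrow> 'a rel" where
  "commutator1 \<A> R S =
     {(z, w). \<exists>x \<in> carrier \<A>. ((x, x), (z, w)) \<in> matrices \<A> R S}\<^sup>+"

end

theory Submission imports Defs begin

text \<open>In a matrix with rows \<open>(x, x)\<close> and \<open>(z, w)\<close>, where \<open>x = t(a, b) = t(a, b')\<close>,
  \<open>z = t(a', b)\<close>, \<open>w = t(a', b')\<close>, \<open>a R a'\<close> and \<open>b (S \<circ> T) b'\<close>, interpolate \<open>b S c T b'\<close>.
  Then \<open>y = t(a', c)\<close> satisfies \<open>z S y T w\<close>, while \<open>u = t(a, c)\<close> satisfies \<open>x S u T x\<close>, so the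
  detour \<open>z R\<^sup>- x (S \<inter> T\<^sup>-) u R y\<close> and the detour \<open>y R\<^sup>- u (S\<^sup>- \<inter> T) x R w\<close> give the two factors.
  The commutator is applied to \<open>R \<inter> (S \<circ> T)\<close> in part (ii) and to \<open>R \<inter> (S \<circ> T) \<inter> (T\<^sup>- \<circ> S\<^sup>-)\<close> in
  part (i). In part (i) the generated tolerance stays inside \<open>S \<circ> T\<close>, because
  \<open>(S \<circ> T) \<inter> (T\<^sup>- \<circ> S\<^sup>-)\<close> is already a tolerance.\<close>

lemma reflexive_compatibleD:
  assumes "reflexive_compatible \<A> R"
  shows "compatible \<A> R" "x \<in> carrier \<A> \<Longrightarrow> (x, x) \<in> R"
  using assms by (auto simp: reflexive_compatible_def refl_on_def)

lemma list_all2_reflI_carrier: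
  assumes "reflexive_compatible \<A> R" "xs \<in> lists (carrier \<A>)"
  shows "list_all2 (\<lambda>x y. (x, y) \<in> R) xs xs"
  using assms by (auto intro!: list.rel_refl_strong reflexive_compatibleD(2))

text \<open>Induction on the term lifts preservation from the basic operations to all term
  operations. The length condition makes \<open>xs ! i\<close> a genuine entry for every variable
  \<open>i < k\<close>.\<close>

lemma eval_term_compatible:
  assumes "compatible \<A> R" "is_term \<A> k t" "list_all2 (\<lambda>x y. (x, y) \<in> R) xs ys" "length xs = k"
  shows "(eval_term \<A> t xs, eval_term \<A> t ys) \<in> R"
  using assms(2)
proof (induction t)
  case (Var i)
  then show ?case using assms(3,4) by (simp add: list_all2_conv_all_nth)
next
  case (App f ts)
  then have "list_all2 (\<lambda>x y. (x, y) \<in> R)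
      (map (\<lambda>t. eval_term \<A> t xs) ts) (map (\<lambda>t. eval_term \<A> t ys) ts)"
    by (auto simp: list.rel_map intro!: list.rel_refl_strong)
  then show ?case using App.prems assms(1) by (simp add: compatible_def)
qed

text \<open>Intermediate elements can be chosen coordinate by coordinate, since the list relator
  commutes with relational composition.\<close>

lemma list_all2_relcompE:
  assumes "list_all2 (\<lambda>x y. (x, y) \<in> R O S) xs zs"
  obtains ys where "list_all2 (\<lambda>x y. (x, y) \<in> R) xs ys" "list_all2 (\<lambda>x y. (x, y) \<in> S) ys zs"
proof -
  have "(\<lambda>x y. (x, y) \<in> R O S) = (\<lambda>x y. (x, y) \<in> R) OO (\<lambda>x y. (x, y) \<in> S)"
    by (auto simp: fun_eq_iff)
  then show ?thesis using assms that by (auto simp: list.rel_compp)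
qed

lemma compatible_relcomp:
  assumes "compatible \<A> R" "compatible \<A> S"
  shows "compatible \<A> (R O S)"
  unfolding compatible_def
proof (intro conjI ballI allI impI)
  show "R O S \<subseteq> carrier \<A> \<times> carrier \<A>"
    using assms by (auto simp: compatible_def)
next
  fix f xs zs
  assume f: "f \<in> symbols \<A>"
    and xs: "length xs = arity \<A> f \<and> list_all2 (\<lambda>x y. (x, y) \<in> R O S) xs zs"
  from xs obtain ys where ys: "list_all2 (\<lambda>x y. (x, y) \<in> R) xs ys" "list_all2 (\<lambda>x y. (x, y) \<in> S) ys zs"
    by (blast elim: list_all2_relcompE)
  then have "length ys = arity \<A> f" using xs by (simp add: list_all2_lengthD)
  then show "(interp \<A> f xs, interp \<A> f zs) \<in> R O S"
    using assms f xs ys unfolding compatible_def by blast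
qed

lemma compatible_Int:
  assumes "compatible \<A> R" "compatible \<A> S"
  shows "compatible \<A> (R \<inter> S)"
  using assms unfolding compatible_def by (auto simp: list_all2_conv_all_nth)

lemma compatible_converse:
  assumes "compatible \<A> R"
  shows "compatible \<A> (R\<inverse>)"
  using assms unfolding compatible_def by (auto simp: list_all2_conv_all_nth)

lemma reflexive_compatible_relcomp:
  assumes "reflexive_compatible \<A> R" "reflexive_compatible \<A> S"
  shows "reflexive_compatible \<A> (R O S)"
  using assms compatible_relcomp unfolding reflexive_compatible_def refl_on_def by blast

lemma reflexive_compatible_Int:
  assumes "reflexive_compatible \<A> R" "reflexive_compatible \<A> S"
  shows "reflexive_compatible \<A> (R \<inter> S)"
  using assms compatible_Int unfolding reflexive_compatible_def refl_on_def by blast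

lemma reflexive_compatible_converse:
  assumes "reflexive_compatible \<A> R"
  shows "reflexive_compatible \<A> (R\<inverse>)"
  using assms compatible_converse unfolding reflexive_compatible_def refl_on_def by blast

text \<open>\<open>P\<close> and \<open>Q\<close> are kept apart from the bounds \<open>R\<close>
  and \<open>S O T\<close> because the two hypotheses on commutators put different relations in the
  second argument.\<close>

lemma matrix_factorization:
  assumes R: "reflexive_compatible \<A> R" and S: "reflexive_compatible \<A> S"
    and T: "reflexive_compatible \<A> T"
    and "P \<subseteq> R" "Q \<subseteq> S O T" and M: "((x, x), (z, w)) \<in> matrices \<A> P Q"
  shows "(z, w) \<in> (S \<inter> (R\<inverse> O (S \<inter> T\<inverse>) O R)) O (T \<inter> (R\<inverse> O (S\<inverse> \<inter> T) O R))"
proof -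
  from M obtain n m f a a' b b' where f: "f \<in> term_operations \<A> (m + n)"
    and x: "x = f (a @ b)" "x = f (a @ b')" and z: "z = f (a' @ b)" and w: "w = f (a' @ b')"
    and n: "length a = n" "length a' = n" and m: "length b = m" "length b' = m"
    and car: "a \<in> lists (carrier \<A>)" "a' \<in> lists (carrier \<A>)"
      "b \<in> lists (carrier \<A>)" "b' \<in> lists (carrier \<A>)"
    and aP: "list_all2 (\<lambda>x y. (x, y) \<in> P) a a'" and bQ: "list_all2 (\<lambda>x y. (x, y) \<in> Q) b b'"
    unfolding matrices_def mem_Collect_eq prod.inject by blast
  from f obtain t where t: "is_term \<A> (m + n) t" and f_eq: "f = eval_term \<A> t"
    by (auto simp: term_operations_def)
  have aR: "list_all2 (\<lambda>x y. (x, y) \<in> R) a a'"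
    using aP \<open>P \<subseteq> R\<close> by (auto elim!: list_all2_mono)
  have "list_all2 (\<lambda>x y. (x, y) \<in> S O T) b b'"
    using bQ \<open>Q \<subseteq> S O T\<close> by (auto elim!: list_all2_mono)
  then obtain c where c: "list_all2 (\<lambda>x y. (x, y) \<in> S) b c" "list_all2 (\<lambda>x y. (x, y) \<in> T) c b'"
    by (rule list_all2_relcompE)
  have len_c: "length c = length b" using c(1) by (simp add: list_all2_lengthD)
  \<comment> \<open>Membership in the base set allows reflexivity to be used on \<open>c\<close>
    when only the first block of arguments moves.\<close>
  have c_car: "c \<in> lists (carrier \<A>)"
    using c(1) reflexive_compatibleD(1)[OF S]
    by (fastforce simp: compatible_def list_all2_conv_all_nth in_set_conv_nth)
  \<comment> \<open>Each pair required below arises by moving one block of arguments along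
    \<open>V\<close> while the other block stays fixed by reflexivity.\<close>
  have eval: "(f (p @ q), f (p' @ q')) \<in> V"
    if "reflexive_compatible \<A> V" "list_all2 (\<lambda>x y. (x, y) \<in> V) p p'"
      "list_all2 (\<lambda>x y. (x, y) \<in> V) q q'" "length p + length q = m + n" for V p p' q q'
    unfolding f_eq using that by (intro eval_term_compatible[OF reflexive_compatibleD(1) t] list_all2_appendI) auto
  define u where "u = f (a @ c)"
  define y where "y = f (a' @ c)"
  note refl = list_all2_reflI_carrier
  have "(x, z) \<in> R" "(x, w) \<in> R" "(u, y) \<in> R"
    using eval[OF R aR refl[OF R, of b]] eval[OF R aR refl[OF R, of b']]
      eval[OF R aR refl[OF R, of c]] car c_car x z w n m len_c by (auto simp: u_def y_def)
  moreover have "(x, u) \<in> S" "(z, y) \<in> S"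
    using eval[OF S refl[OF S, of a] c(1)] eval[OF S refl[OF S, of a'] c(1)]
      car x z n m by (auto simp: u_def y_def)
  moreover have "(u, x) \<in> T" "(y, w) \<in> T"
    using eval[OF T refl[OF T, of a] c(2)] eval[OF T refl[OF T, of a'] c(2)]
      car x w n m len_c by (auto simp: u_def y_def)
  ultimately show ?thesis by blast
qed

text \<open>Transitive closure is monotone, so it is enough to factor the generating pairs, which
  are the second rows of matrices with constant first row.\<close>

lemma commutator1_factorization:
  assumes "reflexive_compatible \<A> R" "reflexive_compatible \<A> S" "reflexive_compatible \<A> T"
    and "P \<subseteq> R" "Q \<subseteq> S O T"
  shows "commutator1 \<A> P Q \<subseteq>
    ((S \<inter> (R\<inverse> O (S \<inter> T\<inverse>) O R)) O (T \<inter> (R\<inverse> O (S\<inverse> \<inter> T) O R)))\<^sup>+"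
  unfolding commutator1_def
  by (rule trancl_mono_subset) (use matrix_factorization[OF assms] in blast)

lemma congruence_reflexive_compatible:
  "congruence \<A> \<gamma> \<Longrightarrow> reflexive_compatible \<A> \<gamma>"
  by (simp add: congruence_def reflexive_compatible_def equiv_def)

text \<open>Each detour consists of three steps inside \<gamma>, so symmetry and transitivity place
  its endpoints in \<gamma>.\<close>

lemma congruence_detours:
  assumes "congruence \<A> \<gamma>" "S \<inter> T\<inverse> \<subseteq> \<gamma>"
  shows "((S \<inter> (\<gamma>\<inverse> O (S \<inter> T\<inverse>) O \<gamma>)) O (T \<inter> (\<gamma>\<inverse> O (S\<inverse> \<inter> T) O \<gamma>)))\<^sup>+
    \<subseteq> ((\<gamma> \<inter> S) O (\<gamma> \<inter> T))\<^sup>+"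
proof -
  have \<gamma>: "\<gamma>\<inverse> = \<gamma>" "\<gamma> O \<gamma> \<subseteq> \<gamma>"
    using assms(1) by (auto simp: congruence_def equiv_def sym_conv_converse_eq trans_O_subset)
  \<comment> \<open>This relation is the converse of \<open>S \<inter> T\<inverse>\<close>, and
    \<gamma> is symmetric.\<close>
  have "S\<inverse> \<inter> T \<subseteq> \<gamma>" using assms(2) \<gamma>(1) by blast
  then have "\<gamma>\<inverse> O (S\<inverse> \<inter> T) O \<gamma> \<subseteq> \<gamma>" "\<gamma>\<inverse> O (S \<inter> T\<inverse>) O \<gamma> \<subseteq> \<gamma>"
    using assms(2) \<gamma> by blast+
  then show ?thesis by (intro trancl_mono_subset relcomp_mono) auto
qed

theorem theorem5:
  fixes \<A> :: "('a, 'f) alg"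
  assumes "is_algebra \<A>"
  shows
    "((\<forall>R. reflexive_compatible \<A> R \<longrightarrow> R \<subseteq> commutator1 \<A> R (tolerance_generated \<A> R)) \<longrightarrow>
        (\<forall>R S T. reflexive_compatible \<A> R \<and> reflexive_compatible \<A> S \<and> reflexive_compatible \<A> T \<longrightarrow>
           R \<inter> (S O T) \<inter> (T\<inverse> O S\<inverse>) \<subseteq>
             ((S \<inter> (R\<inverse> O (S \<inter> T\<inverse>) O R)) O (T \<inter> (R\<inverse> O (S\<inverse> \<inter> T) O R)))\<^sup>+) \<and>
        (\<forall>S T \<gamma>. reflexive_compatible \<A> S \<and> reflexive_compatible \<A> T \<and>
           congruence \<A> \<gamma> \<and> S \<inter> T\<inverse> \<subseteq> \<gamma> \<longrightarrow>
           \<gamma> \<inter> (S O T) \<inter> (T\<inverse> O S\<inverse>) \<subseteq> ((\<gamma> \<inter> S) O (\<gamma> \<inter> T))\<^sup>+)) \<and>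
     ((\<forall>R. reflexive_compatible \<A> R \<longrightarrow> R \<subseteq> commutator1 \<A> R R) \<longrightarrow>
        (\<forall>R S T. reflexive_compatible \<A> R \<and> reflexive_compatible \<A> S \<and> reflexive_compatible \<A> T \<longrightarrow>
           R \<inter> (S O T) \<subseteq>
             ((S \<inter> (R\<inverse> O (S \<inter> T\<inverse>) O R)) O (T \<inter> (R\<inverse> O (S\<inverse> \<inter> T) O R)))\<^sup>+) \<and>
        (\<forall>S T \<gamma>. reflexive_compatible \<A> S \<and> reflexive_compatible \<A> T \<and>
           congruence \<A> \<gamma> \<and> S \<inter> T\<inverse> \<subseteq> \<gamma> \<longrightarrow>
           \<gamma> \<inter> (S O T) \<subseteq> ((\<gamma> \<inter> S) O (\<gamma> \<inter> T))\<^sup>+))"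
proof (rule conjI; intro impI)
  assume H: "\<forall>R. reflexive_compatible \<A> R \<longrightarrow> R \<subseteq> commutator1 \<A> R (tolerance_generated \<A> R)"
  have main: "R \<inter> (S O T) \<inter> (T\<inverse> O S\<inverse>) \<subseteq>
      ((S \<inter> (R\<inverse> O (S \<inter> T\<inverse>) O R)) O (T \<inter> (R\<inverse> O (S\<inverse> \<inter> T) O R)))\<^sup>+"
    if R: "reflexive_compatible \<A> R" and S: "reflexive_compatible \<A> S"
      and T: "reflexive_compatible \<A> T" for R S T
  proof -
    let ?\<Theta> = "(S O T) \<inter> (T\<inverse> O S\<inverse>)"
    let ?P = "R \<inter> (S O T) \<inter> (T\<inverse> O S\<inverse>)"
    have \<Theta>: "reflexive_compatible \<A> ?\<Theta>"
      by (intro reflexive_compatible_Int reflexive_compatible_relcomp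
          reflexive_compatible_converse S T)
    have P: "reflexive_compatible \<A> ?P"
      using reflexive_compatible_Int[OF R \<Theta>] by (simp add: Int_assoc)
    \<comment> \<open>Symmetry holds because \<open>T\<inverse> O S\<inverse>\<close> is the
      converse of \<open>S O T\<close>.\<close>
    have "tolerance \<A> ?\<Theta>"
      using \<Theta> by (auto simp: reflexive_compatible_def tolerance_def sym_def)
    moreover have "?P \<subseteq> carrier \<A> \<times> carrier \<A>"
      using P by (auto simp: reflexive_compatible_def compatible_def)
    ultimately have "tolerance_generated \<A> ?P \<subseteq> ?\<Theta>"
      by (intro tolerance_generated_least(3)[OF assms]) auto
    then have "commutator1 \<A> ?P (tolerance_generated \<A> ?P) \<subseteq>
        ((S \<inter> (R\<inverse> O (S \<inter> T\<inverse>) O R)) O (T \<inter> (R\<inverse> O (S\<inverse> \<inter> T) O R)))\<^sup>+"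
      by (intro commutator1_factorization R S T) auto
    then show ?thesis using H P by blast
  qed
  show "(\<forall>R S T. reflexive_compatible \<A> R \<and> reflexive_compatible \<A> S \<and> reflexive_compatible \<A> T \<longrightarrow>
           R \<inter> (S O T) \<inter> (T\<inverse> O S\<inverse>) \<subseteq>
             ((S \<inter> (R\<inverse> O (S \<inter> T\<inverse>) O R)) O (T \<inter> (R\<inverse> O (S\<inverse> \<inter> T) O R)))\<^sup>+) \<and>
        (\<forall>S T \<gamma>. reflexive_compatible \<A> S \<and> reflexive_compatible \<A> T \<and>
           congruence \<A> \<gamma> \<and> S \<inter> T\<inverse> \<subseteq> \<gamma> \<longrightarrow>
           \<gamma> \<inter> (S O T) \<inter> (T\<inverse> O S\<inverse>) \<subseteq> ((\<gamma> \<inter> S) O (\<gamma> \<inter> T))\<^sup>+)"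
    \<comment> \<open>The first conjunct is \<open>main\<close>; the second is \<open>main\<close>
      at \<open>R = \<gamma>\<close>, followed by absorbing the detours into \<gamma>.\<close>
    by (intro conjI allI impI; elim conjE)
      (rule main subset_trans[OF main congruence_detours];
        (assumption | erule congruence_reflexive_compatible))+
next
  assume H: "\<forall>R. reflexive_compatible \<A> R \<longrightarrow> R \<subseteq> commutator1 \<A> R R"
  have main: "R \<inter> (S O T) \<subseteq>
      ((S \<inter> (R\<inverse> O (S \<inter> T\<inverse>) O R)) O (T \<inter> (R\<inverse> O (S\<inverse> \<inter> T) O R)))\<^sup>+"
    if R: "reflexive_compatible \<A> R" and S: "reflexive_compatible \<A> S"
      and T: "reflexive_compatible \<A> T" for R S T
  proof -
    let ?P = "R \<inter> (S O T)"
    have "reflexive_compatible \<A> ?P"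
      by (intro reflexive_compatible_Int reflexive_compatible_relcomp R S T)
    \<comment> \<open>Both arguments are \<open>?P\<close>, which lies in \<open>R\<close> and in
      \<open>S O T\<close> by construction.\<close>
    moreover have "commutator1 \<A> ?P ?P \<subseteq>
        ((S \<inter> (R\<inverse> O (S \<inter> T\<inverse>) O R)) O (T \<inter> (R\<inverse> O (S\<inverse> \<inter> T) O R)))\<^sup>+"
      by (intro commutator1_factorization R S T) auto
    ultimately show ?thesis using H by blast
  qed
  show "(\<forall>R S T. reflexive_compatible \<A> R \<and> reflexive_compatible \<A> S \<and> reflexive_compatible \<A> T \<longrightarrow>
           R \<inter> (S O T) \<subseteq>
             ((S \<inter> (R\<inverse> O (S \<inter> T\<inverse>) O R)) O (T \<inter> (R\<inverse> O (S\<inverse> \<inter> T) O R)))\<^sup>+) \<and>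
        (\<forall>S T \<gamma>. reflexive_compatible \<A> S \<and> reflexive_compatible \<A> T \<and>
           congruence \<A> \<gamma> \<and> S \<inter> T\<inverse> \<subseteq> \<gamma> \<longrightarrow>
           \<gamma> \<inter> (S O T) \<subseteq> ((\<gamma> \<inter> S) O (\<gamma> \<inter> T))\<^sup>+)"
    by (intro conjI allI impI; elim conjE)
      (rule main subset_trans[OF main congruence_detours];
        (assumption | erule congruence_reflexive_compatible))+
qed

end
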